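(* Let $G$ be a finite group, let $\psi,\psi'\in\operatorname{Aut}(G)$, and let $Q=Q(G,\psi)$ and $Q'=Q(G,\psi')$. (a) If $\psi'=\tau\psi\tau^{-1}$ for some $\tau\in\operatorname{Aut}(G)$, then $Q\cong_Q Q'$. (b) If $Q\cong_Q Q'$, then all of the following hold: (i) the orders of $\psi$ and $\psi'$ in $\operatorname{Aut}(G)$ are equal; (ii) $[G:\operatorname{Fix}(\psi,G)]=[G:\operatorname{Fix}(\psi',G)]$, i.e., $|\operatorname{Fix}(\psi,G)|=|\operatorname{Fix}(\psi',G)|$; (iii) $\operatorname{Inn}(Q)$ and $\operatorname{Inn}(Q')$ are isomorphic as groups; (iv) $Q(G,\psi^i)\cong_Q Q(G,\psi'^i)$ for every positive integer $i$.
   Context: A quandle is a set $Q$ with maps $s_x:Q\to Q$ ($x\in Q$) such that $s_x(x)=x$, each $s_x$ is a bijection, and $s_x\circ s_y=s_{s_x(y)}\circ s_x$ for all $x,y\in Q$. A quandle homomorphism $f:(Q,s)\to(Q',s')$ is a map with $f\circ s_x=s'_{f(x)}\circ f$ for all $x\in Q$; a bijective quandle homomorphism is a quandle isomorphism, and $Q\cong_Q Q'$ means that a quandle isomorphism exists. For a quandle $Q$, $\operatorname{Inn}(Q)$ is the group of bijections of $Q$ generated by $\{s_x:x\in Q\}$. For a group $G$ and $\psi\in\operatorname{Aut}(G)$, $Q(G,\psi)$ is the quandle with underlying set $G$ and $s_g(h)=g\psi(g^{-1}h)$ for $g,h\in G$, and $\operatorname{Fix}(\psi,G)=\{g\in G:\psi(g)=g\}$.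 *)

theory Defs
  imports "HOL-Algebra.Algebra"
begin

record 'a quandle = "'a partial_object" +
  qsym :: "'a \<Rightarrow> 'a \<Rightarrow> 'a"

text \<open>The map \<open>s\<^sub>x\<close> is \<open>qsym Q x\<close>; only its values on \<open>carrier Q\<close> are relevant.\<close>

locale quandle =
  fixes Q :: "('a, 'q) quandle_scheme"
  assumes qsym_idem: "x \<in> carrier Q \<Longrightarrow> qsym Q x x = x"
    and qsym_bij: "x \<in> carrier Q \<Longrightarrow> bij_betw (qsym Q x) (carrier Q) (carrier Q)"
    and qsym_distrib: "\<lbrakk>x \<in> carrier Q; y \<in> carrier Q; z \<in> carrier Q\<rbrakk>
      \<Longrightarrow> qsym Q x (qsym Q y z) = qsym Q (qsym Q x y) (qsym Q x z)"

definition quandle_hom ::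
    "('a, 'q) quandle_scheme \<Rightarrow> ('b, 'r) quandle_scheme \<Rightarrow> ('a \<Rightarrow> 'b) set" where
  "quandle_hom Q Q' = {f \<in> carrier Q \<rightarrow> carrier Q'.
     \<forall>x\<in>carrier Q. \<forall>y\<in>carrier Q. f (qsym Q x y) = qsym Q' (f x) (f y)}"

definition quandle_iso ::
    "('a, 'q) quandle_scheme \<Rightarrow> ('b, 'r) quandle_scheme \<Rightarrow> ('a \<Rightarrow> 'b) set" where
  "quandle_iso Q Q' = {f \<in> quandle_hom Q Q'. bij_betw f (carrier Q) (carrier Q')}"

definition is_quandle_iso ::
    "('a, 'q) quandle_scheme \<Rightarrow> ('b, 'r) quandle_scheme \<Rightarrow> bool" (infix "\<cong>\<^sub>Q" 60) where
  "Q \<cong>\<^sub>Q Q' \<longleftrightarrow> quandle_iso Q Q' \<noteq> {}"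

text \<open>\<open>BijGroup S\<close> consists of the extensional bijections of \<open>S\<close>, hence the restriction of
  the generators.\<close>

definition Inn :: "('a, 'q) quandle_scheme \<Rightarrow> ('a \<Rightarrow> 'a) monoid" where
  "Inn Q = subgroup_generated (BijGroup (carrier Q))
     ((\<lambda>x. restrict (qsym Q x) (carrier Q)) ` carrier Q)"

definition group_quandle :: "('a, 'm) monoid_scheme \<Rightarrow> ('a \<Rightarrow> 'a) \<Rightarrow> 'a quandle" where
  "group_quandle G \<psi> =
     \<lparr>carrier = carrier G, qsym = (\<lambda>g h. g \<otimes>\<^bsub>G\<^esub> \<psi> (inv\<^bsub>G\<^esub> g \<otimes>\<^bsub>G\<^esub> h))\<rparr>"

definition Fix :: "('a \<Rightarrow> 'a) \<Rightarrow> ('a, 'm) monoid_scheme \<Rightarrow> 'a set" where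
  "Fix \<psi> G = {g \<in> carrier G. \<psi> g = g}"

text \<open>\<open>subgroup_generated\<close> intersects the generating set with the carrier of the ambient group;
  by the following lemma, nothing is lost in the definition of \<open>Inn\<close>.\<close>

lemma (in quandle) qsym_in_BijGroup:
  "(\<lambda>x. restrict (qsym Q x) (carrier Q)) ` carrier Q \<subseteq> carrier (BijGroup (carrier Q))"
  using qsym_bij by (auto simp: BijGroup_def Bij_def cong: bij_betw_cong)

lemma (in group) quandle_group_quandle:
  assumes "\<psi> \<in> carrier (AutoGroup G)"
  shows "quandle (group_quandle G \<psi>)"
proof -
  have hom: "\<psi> \<in> hom G G" and bij: "bij_betw \<psi> (carrier G) (carrier G)"
    using assms by (auto simp: AutoGroup_def auto_def Bij_def)
  interpret group_hom G G \<psi>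
    using hom by unfold_locales
  have canc: "a \<otimes> (inv a \<otimes> b) = b" "inv a \<otimes> (a \<otimes> b) = b"
    if "a \<in> carrier G" "b \<in> carrier G" for a b
    using that by (simp_all add: m_assoc[symmetric])
  have lt: "bij_betw (\<lambda>h. a \<otimes> h) (carrier G) (carrier G)" if "a \<in> carrier G" for a
    by (rule bij_betw_byWitness[where f' = "\<lambda>h. inv a \<otimes> h"])
      (use that in \<open>auto simp: m_assoc[symmetric]\<close>)
  show ?thesis
  proof
    fix x assume "x \<in> carrier (group_quandle G \<psi>)"
    then have x: "x \<in> carrier G" by (simp add: group_quandle_def)
    show "qsym (group_quandle G \<psi>) x x = x"
      using x by (simp add: group_quandle_def)
    have "bij_betw ((\<lambda>h. x \<otimes> h) \<circ> (\<psi> \<circ> (\<lambda>h. inv x \<otimes> h))) (carrier G) (carrier G)"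
      using lt[of x] lt[of "inv x"] bij x by (blast intro: bij_betw_trans inv_closed)
    then show "bij_betw (qsym (group_quandle G \<psi>) x)
        (carrier (group_quandle G \<psi>)) (carrier (group_quandle G \<psi>))"
      by (simp add: group_quandle_def comp_def)
  next
    fix x y z
    assume "x \<in> carrier (group_quandle G \<psi>)" "y \<in> carrier (group_quandle G \<psi>)"
      "z \<in> carrier (group_quandle G \<psi>)"
    then have "x \<in> carrier G" "y \<in> carrier G" "z \<in> carrier G"
      by (simp_all add: group_quandle_def)
    then show "qsym (group_quandle G \<psi>) x (qsym (group_quandle G \<psi>) y z) =
        qsym (group_quandle G \<psi>) (qsym (group_quandle G \<psi>) x y) (qsym (group_quandle G \<psi>) x z)"
      by (simp add: group_quandle_def m_assoc inv_mult_group canc)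
  qed
qed

end

theory Submission
  imports Defs
begin

text \<open>Left translations are automorphisms of \<open>group_quandle G \<psi>\<close>, so a quandle isomorphism may be
  normalised to fix the unit; since \<open>qsym _ \<one> = \<psi>\<close>, it then conjugates \<open>\<psi>\<close> to \<open>\<psi>'\<close> as
  permutations, which determines the order and the number of fixed points. Inner automorphism
  groups correspond under conjugation by the isomorphism, and powers of \<open>\<psi>\<close> give the powers of
  the maps \<open>s\<^sub>x\<close>, which the isomorphism intertwines as well.\<close>

section \<open>Transport of permutation groups and inner automorphism groups along a
  bijection\<close>

text \<open>Conjugation by \<open>f\<close> respects composition and is undone by conjugation by its
  inverse. The restriction to \<open>T\<close> is there because elements of
  \<open>BijGroup T\<close> are extensional.\<close>

lemma conj_iso_BijGroup:
  assumes f: "bij_betw f S T"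
  shows "(\<lambda>\<phi>. \<lambda>y\<in>T. f (\<phi> (inv_into S f y))) \<in> iso (BijGroup S) (BijGroup T)"
proof -
  let ?g = "inv_into S f"
  let ?c = "\<lambda>\<phi>. \<lambda>y\<in>T. f (\<phi> (?g y))"
  \<comment> \<open>Conjugation in the other direction, the two-sided inverse of
    \<open>?c\<close>.\<close>
  let ?d = "\<lambda>\<phi>. \<lambda>x\<in>S. ?g (\<phi> (f x))"
  have g: "bij_betw ?g T S" by (rule bij_betw_inv_into[OF f])
  have fg: "f (?g y) = y" if "y \<in> T" for y using f that by (simp add: bij_betw_inv_into_right)
  have gf: "?g (f x) = x" if "x \<in> S" for x using f that by (simp add: bij_betw_inv_into_left)
  have fS: "f x \<in> T" if "x \<in> S" for x using f that by (rule bij_betw_apply)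
  have gT: "?g y \<in> S" if "y \<in> T" for y using g that by (rule bij_betw_apply)
  have Bij_S: "\<phi> x \<in> S" if "\<phi> \<in> Bij S" "x \<in> S" for \<phi> x
    using that by (auto simp: Bij_def bij_betw_apply)
  have Bij_T: "\<phi> x \<in> T" if "\<phi> \<in> Bij T" "x \<in> T" for \<phi> x
    using that by (auto simp: Bij_def bij_betw_apply)
  have c: "?c \<phi> \<in> Bij T" if "\<phi> \<in> Bij S" for \<phi>
  proof -
    have "bij_betw (f \<circ> (\<phi> \<circ> ?g)) T T"
      using f g that unfolding Bij_def by (blast intro: bij_betw_trans)
    then show ?thesis by (simp add: Bij_def comp_def cong: bij_betw_cong)
  qed
  have d: "?d \<phi> \<in> Bij S" if "\<phi> \<in> Bij T" for \<phi>
  proof -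
    have "bij_betw (?g \<circ> (\<phi> \<circ> f)) S S"
      using f g that unfolding Bij_def by (blast intro: bij_betw_trans)
    then show ?thesis by (simp add: Bij_def comp_def cong: bij_betw_cong)
  qed
  have hom: "?c \<in> hom (BijGroup S) (BijGroup T)"
  proof (rule homI)
    show "?c \<phi> \<in> carrier (BijGroup T)" if "\<phi> \<in> carrier (BijGroup S)" for \<phi>
      using c that by (simp add: BijGroup_def)
    show "?c (\<phi> \<otimes>\<^bsub>BijGroup S\<^esub> \<chi>) = ?c \<phi> \<otimes>\<^bsub>BijGroup T\<^esub> ?c \<chi>"
      if "\<phi> \<in> carrier (BijGroup S)" "\<chi> \<in> carrier (BijGroup S)" for \<phi> \<chi>
      using that c by (auto simp: BijGroup_def compose_def gT gf fS Bij_S intro!: restrict_ext)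
  qed
  moreover have "bij_betw ?c (carrier (BijGroup S)) (carrier (BijGroup T))"
  proof (rule bij_betw_byWitness[where f' = ?d])
    show "\<forall>\<phi>\<in>carrier (BijGroup S). ?d (?c \<phi>) = \<phi>"
      by (auto simp: BijGroup_def gf fS Bij_S dest: Bij_imp_extensional
          intro: extensionalityI[where A = S])
    show "\<forall>\<phi>\<in>carrier (BijGroup T). ?c (?d \<phi>) = \<phi>"
      by (auto simp: BijGroup_def fg gT Bij_T dest: Bij_imp_extensional
          intro: extensionalityI[where A = T])
    show "?c ` carrier (BijGroup S) \<subseteq> carrier (BijGroup T)"
      using c by (auto simp: BijGroup_def)
    show "?d ` carrier (BijGroup T) \<subseteq> carrier (BijGroup S)"
      using d by (auto simp: BijGroup_def)
  qed
  ultimately show ?thesis by (simp add: iso_def)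
qed

lemma iso_subgroup_generated_image:
  assumes "group G" "group H" and h: "h \<in> iso G H" and A: "A \<subseteq> carrier G"
  shows "h \<in> iso (subgroup_generated G A) (subgroup_generated H (h ` A))"
proof -
  interpret group_hom G H h
    using assms by (auto simp: group_hom_def group_hom_axioms_def iso_def)
  have im: "carrier (subgroup_generated H (h ` A)) = h ` carrier (subgroup_generated G A)"
    by (rule subgroup_generated_by_image[OF A])
  have "inj_on h (carrier (subgroup_generated G A))"
    by (rule inj_on_subset[OF _ G.carrier_subgroup_generated_subset])
      (use h in \<open>simp add: iso_def bij_betw_def\<close>)
  moreover have "h \<in> hom (subgroup_generated G A) (subgroup_generated H (h ` A))"
    using im by (simp add: hom_into_subgroup_eq_gen[OF assms(2)] G.hom_from_subgroup_generated homh)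
  ultimately show ?thesis
    using im by (simp add: iso_def bij_betw_def)
qed

text \<open>Conjugation by a quandle isomorphism \<open>f\<close> turns s_x into s'_(f x), so it
  maps the generators of \<open>Inn Q\<close> onto those of \<open>Inn Q'\<close> and restricts to
  an isomorphism of the generated groups.\<close>

lemma Inn_cong:
  assumes Q: "quandle Q" and iso: "Q \<cong>\<^sub>Q Q'"
  shows "Inn Q \<cong> Inn Q'"
proof -
  interpret quandle Q by fact
  let ?S = "carrier Q" and ?T = "carrier Q'"
  obtain f where bij: "bij_betw f ?S ?T"
    and hom: "\<And>x y. x \<in> ?S \<Longrightarrow> y \<in> ?S \<Longrightarrow> f (qsym Q x y) = qsym Q' (f x) (f y)"
    using iso by (auto simp: is_quandle_iso_def quandle_iso_def quandle_hom_def)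
  let ?c = "\<lambda>\<phi>. \<lambda>y\<in>?T. f (\<phi> (inv_into ?S f y))"
  let ?gen = "(\<lambda>x. restrict (qsym Q x) ?S) ` ?S"
  \<comment> \<open>This is the homomorphism law for \<open>f\<close>, evaluated at \<open>x\<close>
    and the preimage of a point of \<open>?T\<close>.\<close>
  have "?c (restrict (qsym Q x) ?S) = restrict (qsym Q' (f x)) ?T" if "x \<in> ?S" for x
    using bij that hom
    by (auto simp: bij_betw_inv_into_right bij_betw_apply[OF bij_betw_inv_into] intro!: restrict_ext)
  then have "?c ` ?gen = (\<lambda>x. restrict (qsym Q' (f x)) ?T) ` ?S"
    by (simp add: image_image cong: image_cong_simp)
  \<comment> \<open>As \<open>f\<close> is onto \<open>?T\<close>, the indices \<open>f x\<close>
    exhaust \<open>?T\<close>.\<close>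
  also have "\<dots> = (\<lambda>y. restrict (qsym Q' y) ?T) ` ?T"
    by (simp add: image_image bij_betw_imp_surj_on[OF bij, symmetric])
  finally have gen: "?c ` ?gen = (\<lambda>y. restrict (qsym Q' y) ?T) ` ?T" .
  have "?c \<in> iso (Inn Q) (Inn Q')"
    unfolding Inn_def gen[symmetric]
    by (intro iso_subgroup_generated_image group_BijGroup conj_iso_BijGroup bij qsym_in_BijGroup)
  then show ?thesis by (auto simp: is_iso_def)
qed

section \<open>Automorphisms, their powers, and the quandles they define\<close>

context group
begin

lemma AutoGroup_closed:
  assumes "\<psi> \<in> carrier (AutoGroup G)"
  shows "x \<in> carrier G \<Longrightarrow> \<psi> x \<in> carrier G"
    and "x \<in> carrier G \<Longrightarrow> y \<in> carrier G \<Longrightarrow> \<psi> (x \<otimes> y) = \<psi> x \<otimes> \<psi> y"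
    and "bij_betw \<psi> (carrier G) (carrier G)"
  using assms by (auto simp: AutoGroup_def auto_def Bij_def hom_def)

lemma AutoGroup_group_hom:
  assumes "\<psi> \<in> carrier (AutoGroup G)"
  shows "group_hom G G \<psi>"
  using assms by unfold_locales (auto simp: AutoGroup_def auto_def)

lemma AutoGroup_mult:
  assumes "\<psi> \<in> carrier (AutoGroup G)" "\<phi> \<in> carrier (AutoGroup G)" "x \<in> carrier G"
  shows "(\<psi> \<otimes>\<^bsub>AutoGroup G\<^esub> \<phi>) x = \<psi> (\<phi> x)"
  using assms by (auto simp: AutoGroup_def auto_def BijGroup_def compose_def)

lemma AutoGroup_eq_iff:
  assumes "\<psi> \<in> carrier (AutoGroup G)" "\<phi> \<in> carrier (AutoGroup G)"
  shows "\<psi> = \<phi> \<longleftrightarrow> (\<forall>x\<in>carrier G. \<psi> x = \<phi> x)"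
  using assms
  by (auto simp: AutoGroup_def auto_def Bij_def intro: extensionalityI[where A = "carrier G"])

text \<open>Reduces powers in \<open>AutoGroup G\<close> to iterates of functions. They agree only
  on the carrier: group powers are extensional, whereas the zeroth iterate is the identity
  everywhere.\<close>

lemma AutoGroup_pow:
  fixes n :: nat
  assumes \<psi>: "\<psi> \<in> carrier (AutoGroup G)" and "x \<in> carrier G"
  shows "(\<psi> [^]\<^bsub>AutoGroup G\<^esub> n) x = (\<psi> ^^ n) x"
proof -
  interpret A: group "AutoGroup G" by (rule AutoGroup)
  have one: "\<one>\<^bsub>AutoGroup G\<^esub> x = x" if "x \<in> carrier G" for x
    using that by (simp add: AutoGroup_def BijGroup_def)
  show ?thesis
    using \<open>x \<in> carrier G\<close>
    \<comment> \<open>The group power puts the extra factor on the right, so the induction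
      hypothesis is applied at \<open>\<psi> x\<close>; \<open>funpow_swap1\<close> brings the
      iterate into the same form.\<close>
    by (induction n arbitrary: x)
      (simp_all add: one \<psi> AutoGroup_mult AutoGroup_closed(1)[OF \<psi>] funpow_swap1)
qed

lemma AutoGroup_pow_eq_one_iff:
  fixes n :: nat
  assumes \<psi>: "\<psi> \<in> carrier (AutoGroup G)"
  shows "\<psi> [^]\<^bsub>AutoGroup G\<^esub> n = \<one>\<^bsub>AutoGroup G\<^esub> \<longleftrightarrow> (\<forall>x\<in>carrier G. (\<psi> ^^ n) x = x)"
proof -
  interpret A: group "AutoGroup G" by (rule AutoGroup)
  have "\<one>\<^bsub>AutoGroup G\<^esub> x = x" if "x \<in> carrier G" for x
    using that by (simp add: AutoGroup_def BijGroup_def)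
  then show ?thesis
    using \<psi> by (simp add: AutoGroup_eq_iff AutoGroup_pow)
qed

lemma subgroup_Fix:
  assumes \<psi>: "\<psi> \<in> carrier (AutoGroup G)"
  shows "subgroup (Fix \<psi> G) G"
proof -
  interpret group_hom G G \<psi> by (rule AutoGroup_group_hom[OF \<psi>])
  show ?thesis by (rule subgroupI) (auto simp: Fix_def)
qed

text \<open>The map s_g is \<open>\<psi>\<close> conjugated by left translation by \<open>g\<close>.
  In its iterates the inner translations cancel, which leaves the conjugate of the iterate of
  \<open>\<psi>\<close>.\<close>

lemma group_quandle_pow:
  fixes n :: nat
  assumes \<psi>: "\<psi> \<in> carrier (AutoGroup G)" and g: "g \<in> carrier G" and "h \<in> carrier G"
  shows "qsym (group_quandle G (\<psi> [^]\<^bsub>AutoGroup G\<^esub> n)) g h = (qsym (group_quandle G \<psi>) g ^^ n) h"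
proof -
  have closed: "(\<psi> ^^ n) x \<in> carrier G" if "x \<in> carrier G" for n x
    using that by (induction n) (simp_all add: AutoGroup_closed(1)[OF \<psi>])
  have canc: "inv g \<otimes> (g \<otimes> x) = x" "g \<otimes> (inv g \<otimes> x) = x" if "x \<in> carrier G" for x
    using g that by (simp_all flip: m_assoc)
  have "(qsym (group_quandle G \<psi>) g ^^ n) h = g \<otimes> (\<psi> ^^ n) (inv g \<otimes> h)"
    using g \<open>h \<in> carrier G\<close>
    by (induction n) (simp_all add: group_quandle_def canc closed)
  then show ?thesis
    using assms by (simp add: group_quandle_def AutoGroup_pow)
qed

text \<open>The automorphism \<open>\<tau>\<close> is itself the quandle isomorphism: it is
  multiplicative and intertwines \<open>\<psi>\<close> with its conjugate.\<close>

lemma conjugate_imp_group_quandle_iso: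
  assumes \<psi>: "\<psi> \<in> carrier (AutoGroup G)" and \<tau>: "\<tau> \<in> carrier (AutoGroup G)"
  shows "group_quandle G \<psi> \<cong>\<^sub>Q
    group_quandle G (\<tau> \<otimes>\<^bsub>AutoGroup G\<^esub> \<psi> \<otimes>\<^bsub>AutoGroup G\<^esub> inv\<^bsub>AutoGroup G\<^esub> \<tau>)"
proof -
  interpret A: group "AutoGroup G" by (rule AutoGroup)
  interpret group_hom G G \<tau> by (rule AutoGroup_group_hom[OF \<tau>])
  let ?\<psi>' = "\<tau> \<otimes>\<^bsub>AutoGroup G\<^esub> \<psi> \<otimes>\<^bsub>AutoGroup G\<^esub> inv\<^bsub>AutoGroup G\<^esub> \<tau>"
  \<comment> \<open>Multiplying by \<open>\<tau>\<close> on the right avoids evaluating its inverse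
    at points.\<close>
  have "?\<psi>' \<otimes>\<^bsub>AutoGroup G\<^esub> \<tau> = \<tau> \<otimes>\<^bsub>AutoGroup G\<^esub> \<psi>"
    using \<psi> \<tau> by (simp add: A.m_assoc)
  then have "?\<psi>' (\<tau> x) = \<tau> (\<psi> x)" if "x \<in> carrier G" for x
    using \<psi> \<tau> that by (metis A.inv_closed A.m_closed AutoGroup_mult)
  from this[symmetric] have "\<tau> \<in> quandle_iso (group_quandle G \<psi>) (group_quandle G ?\<psi>')"
    using \<psi> \<tau>
    by (simp add: quandle_iso_def quandle_hom_def group_quandle_def AutoGroup_closed)
  then show ?thesis by (auto simp: is_quandle_iso_def)
qed

end

section \<open>Invariants shared by isomorphic group quandles\<close>

text \<open>Two separate groups keep the source and target of the isomorphism apart; the theorem is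
  the case where both are \<open>G\<close>.\<close>

locale group_quandle_pair = G: group G + H: group H
  for G :: "('a, 'm) monoid_scheme" and H :: "('b, 'n) monoid_scheme" +
  fixes \<psi> \<psi>'
  assumes \<psi>: "\<psi> \<in> carrier (AutoGroup G)" and \<psi>': "\<psi>' \<in> carrier (AutoGroup H)"
    and iso: "group_quandle G \<psi> \<cong>\<^sub>Q group_quandle H \<psi>'"
begin

text \<open>The witness is \<open>f\<close> followed by left translation by the inverse of
  \<open>?u\<close>, which sends unit to unit. It is claimed to be a bijection only, not a group
  homomorphism.\<close>

lemma obtain_conjugating_bij:
  obtains k where "bij_betw k (carrier G) (carrier H)"
    and "\<And>x. x \<in> carrier G \<Longrightarrow> k (\<psi> x) = \<psi>' (k x)"
proof -
  interpret \<psi>: group_hom G G \<psi> by (rule G.AutoGroup_group_hom[OF \<psi>])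
  interpret \<psi>': group_hom H H \<psi>' by (rule H.AutoGroup_group_hom[OF \<psi>'])
  obtain f where bij: "bij_betw f (carrier G) (carrier H)"
    and hom: "\<And>x y. x \<in> carrier G \<Longrightarrow> y \<in> carrier G \<Longrightarrow>
      f (x \<otimes>\<^bsub>G\<^esub> \<psi> (inv\<^bsub>G\<^esub> x \<otimes>\<^bsub>G\<^esub> y)) = f x \<otimes>\<^bsub>H\<^esub> \<psi>' (inv\<^bsub>H\<^esub> f x \<otimes>\<^bsub>H\<^esub> f y)"
    using iso by (auto simp: is_quandle_iso_def quandle_iso_def quandle_hom_def group_quandle_def)
  let ?u = "f \<one>\<^bsub>G\<^esub>"
  have f: "f x \<in> carrier H" if "x \<in> carrier G" for x
    using bij that by (rule bij_betw_apply)
  then have u: "?u \<in> carrier H" by simp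
  have "bij_betw (\<lambda>y. inv\<^bsub>H\<^esub> ?u \<otimes>\<^bsub>H\<^esub> y) (carrier H) (carrier H)"
    by (rule bij_betw_byWitness[where f' = "\<lambda>y. ?u \<otimes>\<^bsub>H\<^esub> y"])
      (use u in \<open>auto simp flip: H.m_assoc\<close>)
  then have "bij_betw (\<lambda>x. inv\<^bsub>H\<^esub> ?u \<otimes>\<^bsub>H\<^esub> f x) (carrier G) (carrier H)"
    using bij_betw_trans[OF bij] by (simp add: comp_def)
  moreover have "inv\<^bsub>H\<^esub> ?u \<otimes>\<^bsub>H\<^esub> f (\<psi> x) = \<psi>' (inv\<^bsub>H\<^esub> ?u \<otimes>\<^bsub>H\<^esub> f x)" if x: "x \<in> carrier G" for x
  proof -
    \<comment> \<open>The homomorphism law at the unit, where the left-hand structure map is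
      \<open>\<psi>\<close>.\<close>
    have "f (\<psi> x) = ?u \<otimes>\<^bsub>H\<^esub> \<psi>' (inv\<^bsub>H\<^esub> ?u \<otimes>\<^bsub>H\<^esub> f x)"
      using hom[of "\<one>\<^bsub>G\<^esub>" x] x by simp
    then show ?thesis
      using u f[OF x] by (simp flip: H.m_assoc)
  qed
  ultimately show thesis by (rule that)
qed

text \<open>The bijection \<open>k\<close> intertwines all iterates, so the \<open>n\<close>-th
  powers are trivial for the same \<open>n\<close>. Stating this by divisibility also covers
  infinite order, encoded as 0.\<close>

lemma ord_eq: "group.ord (AutoGroup G) \<psi> = group.ord (AutoGroup H) \<psi>'"
proof -
  interpret AG: group "AutoGroup G" by (rule G.AutoGroup)
  interpret AH: group "AutoGroup H" by (rule H.AutoGroup)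
  obtain k where bij: "bij_betw k (carrier G) (carrier H)"
    and k: "\<And>x. x \<in> carrier G \<Longrightarrow> k (\<psi> x) = \<psi>' (k x)"
    by (rule obtain_conjugating_bij) blast
  have closed: "(\<psi> ^^ n) x \<in> carrier G" if "x \<in> carrier G" for n x
    using that by (induction n) (simp_all add: G.AutoGroup_closed(1)[OF \<psi>])
  have kn: "k ((\<psi> ^^ n) x) = (\<psi>' ^^ n) (k x)" if "x \<in> carrier G" for n x
    using that by (induction n) (simp_all add: k closed)
  \<comment> \<open>By \<open>kn\<close> both sides of the first equation are values of
    \<open>k\<close>, which is injective.\<close>
  have "(\<psi>' ^^ n) (k x) = k x \<longleftrightarrow> (\<psi> ^^ n) x = x" if "x \<in> carrier G" for n x
    using that bij closed[of x n]
    by (auto simp: bij_betw_def inj_on_eq_iff simp flip: kn)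
  then have "(\<forall>x\<in>carrier G. (\<psi> ^^ n) x = x) \<longleftrightarrow> (\<forall>y\<in>carrier H. (\<psi>' ^^ n) y = y)" for n
    by (simp add: bij_betw_imp_surj_on[OF bij, symmetric])
  then have "AG.ord \<psi> dvd n \<longleftrightarrow> AH.ord \<psi>' dvd n" for n
    using \<psi> \<psi>'
    by (simp flip: AG.pow_eq_id AH.pow_eq_id
        add: G.AutoGroup_pow_eq_one_iff H.AutoGroup_pow_eq_one_iff)
  \<comment> \<open>Taking \<open>n\<close> to be each of the two orders gives divisibility both
    ways.\<close>
  then show ?thesis by (meson dvd_antisym dvd_refl)
qed

text \<open>A bijection that conjugates one permutation to another matches their fixed
  points.\<close>

lemma card_Fix_eq: "card (Fix \<psi> G) = card (Fix \<psi>' H)"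
proof -
  obtain k where bij: "bij_betw k (carrier G) (carrier H)"
    and k: "\<And>x. x \<in> carrier G \<Longrightarrow> k (\<psi> x) = \<psi>' (k x)"
    by (rule obtain_conjugating_bij) blast
  have "\<psi>' (k x) = k x \<longleftrightarrow> \<psi> x = x" if "x \<in> carrier G" for x
    using that bij G.AutoGroup_closed(1)[OF \<psi> that]
    by (auto simp: bij_betw_def inj_on_eq_iff simp flip: k)
  then have "k ` Fix \<psi> G = Fix \<psi>' H"
    by (auto simp: Fix_def bij_betw_imp_surj_on[OF bij, symmetric])
  moreover have "inj_on k (Fix \<psi> G)"
    using bij by (auto simp: bij_betw_def Fix_def intro: inj_on_subset)
  ultimately show ?thesis by (metis card_image)
qed

text \<open>Lagrange on both sides: the group orders agree and so do the fixed subgroups' sizes, and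
  the latter cancel.\<close>

lemma card_rcosets_Fix_eq:
  assumes "finite (carrier G)"
  shows "card (rcosets\<^bsub>G\<^esub> Fix \<psi> G) = card (rcosets\<^bsub>H\<^esub> Fix \<psi>' H)"
proof -
  have "order G = order H"
    using obtain_conjugating_bij by (metis bij_betw_same_card order_def)
  then have "card (rcosets\<^bsub>G\<^esub> Fix \<psi> G) * card (Fix \<psi> G) = card (rcosets\<^bsub>H\<^esub> Fix \<psi>' H) * card (Fix \<psi> G)"
    using G.lagrange[OF G.subgroup_Fix[OF \<psi>]] H.lagrange[OF H.subgroup_Fix[OF \<psi>']] card_Fix_eq
    by (simp add: mult.commute)
  moreover have "\<one>\<^bsub>G\<^esub> \<in> Fix \<psi> G"
    using G.subgroup_Fix[OF \<psi>] by (rule subgroup.one_closed)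
  \<comment> \<open>Finiteness matters here, since an infinite set has \<open>card\<close>
    0.\<close>
  then have "card (Fix \<psi> G) \<noteq> 0"
    using assms by (auto simp: Fix_def)
  ultimately show ?thesis by simp
qed

text \<open>The same \<open>f\<close> works for every \<open>n\<close>: it intertwines s_x with
  s'_(f x), hence their iterates, and by \<open>group_quandle_pow\<close> these are the structure
  maps for the powers.\<close>

lemma group_quandle_pow_iso:
  fixes n :: nat
  shows "group_quandle G (\<psi> [^]\<^bsub>AutoGroup G\<^esub> n) \<cong>\<^sub>Q group_quandle H (\<psi>' [^]\<^bsub>AutoGroup H\<^esub> n)"
proof -
  let ?Q = "group_quandle G \<psi>" and ?Q' = "group_quandle H \<psi>'"
  interpret Q: quandle ?Q by (rule G.quandle_group_quandle[OF \<psi>])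
  have carrier [simp]: "carrier (group_quandle G \<chi>) = carrier G"
    "carrier (group_quandle H \<chi>') = carrier H" for \<chi> \<chi>'
    by (simp_all add: group_quandle_def)
  obtain f where bij: "bij_betw f (carrier G) (carrier H)"
    and hom: "\<And>x y. x \<in> carrier G \<Longrightarrow> y \<in> carrier G \<Longrightarrow> f (qsym ?Q x y) = qsym ?Q' (f x) (f y)"
    using iso by (auto simp: is_quandle_iso_def quandle_iso_def quandle_hom_def)
  have f: "f x \<in> carrier H" if "x \<in> carrier G" for x
    using bij that by (rule bij_betw_apply)
  have closed: "(qsym ?Q x ^^ n) y \<in> carrier G" if "x \<in> carrier G" "y \<in> carrier G" for n x y
    using that Q.qsym_bij[of x] by (induction n) (auto dest: bij_betw_apply)
  have "f ((qsym ?Q x ^^ n) y) = (qsym ?Q' (f x) ^^ n) (f y)"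
    if "x \<in> carrier G" "y \<in> carrier G" for x y
    using that by (induction n) (simp_all add: hom closed)
  then have "f \<in> quandle_iso (group_quandle G (\<psi> [^]\<^bsub>AutoGroup G\<^esub> n))
      (group_quandle H (\<psi>' [^]\<^bsub>AutoGroup H\<^esub> n))"
    using bij f \<psi> \<psi>'
    by (simp add: quandle_iso_def quandle_hom_def G.group_quandle_pow H.group_quandle_pow)
  then show ?thesis by (auto simp: is_quandle_iso_def)
qed

end

theorem theorem4p5:
  fixes G :: "('a, 'm) monoid_scheme" and \<psi> \<psi>' :: "'a \<Rightarrow> 'a"
  assumes "group G" and "finite (carrier G)"
    and "\<psi> \<in> carrier (AutoGroup G)" and "\<psi>' \<in> carrier (AutoGroup G)"
  shows "((\<exists>\<tau>\<in>carrier (AutoGroup G).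
             \<psi>' = \<tau> \<otimes>\<^bsub>AutoGroup G\<^esub> \<psi> \<otimes>\<^bsub>AutoGroup G\<^esub> inv\<^bsub>AutoGroup G\<^esub> \<tau>)
           \<longrightarrow> group_quandle G \<psi> \<cong>\<^sub>Q group_quandle G \<psi>')
    \<and> (group_quandle G \<psi> \<cong>\<^sub>Q group_quandle G \<psi>' \<longrightarrow>
          group.ord (AutoGroup G) \<psi> = group.ord (AutoGroup G) \<psi>'
        \<and> card (rcosets\<^bsub>G\<^esub> (Fix \<psi> G)) = card (rcosets\<^bsub>G\<^esub> (Fix \<psi>' G))
        \<and> card (Fix \<psi> G) = card (Fix \<psi>' G)
        \<and> Inn (group_quandle G \<psi>) \<cong> Inn (group_quandle G \<psi>')
        \<and> (\<forall>i::nat. i > 0 \<longrightarrow>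
             group_quandle G (\<psi> [^]\<^bsub>AutoGroup G\<^esub> i) \<cong>\<^sub>Q group_quandle G (\<psi>' [^]\<^bsub>AutoGroup G\<^esub> i)))"
proof (intro conjI impI)
  interpret G: group G by fact
  let ?Q = "group_quandle G \<psi>" and ?Q' = "group_quandle G \<psi>'"
  show "?Q \<cong>\<^sub>Q ?Q'" if "\<exists>\<tau>\<in>carrier (AutoGroup G).
      \<psi>' = \<tau> \<otimes>\<^bsub>AutoGroup G\<^esub> \<psi> \<otimes>\<^bsub>AutoGroup G\<^esub> inv\<^bsub>AutoGroup G\<^esub> \<tau>"
    using that G.conjugate_imp_group_quandle_iso assms(3) by blast
  assume iso: "?Q \<cong>\<^sub>Q ?Q'"
  \<comment> \<open>Both groups of the pair are taken to be \<open>G\<close>.\<close>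
  interpret group_quandle_pair G G \<psi> \<psi>'
    by unfold_locales (fact assms(3,4) iso)+
  show "group.ord (AutoGroup G) \<psi> = group.ord (AutoGroup G) \<psi>'"
    by (rule ord_eq)
  show "card (rcosets\<^bsub>G\<^esub> (Fix \<psi> G)) = card (rcosets\<^bsub>G\<^esub> (Fix \<psi>' G))"
    by (rule card_rcosets_Fix_eq[OF assms(2)])
  show "card (Fix \<psi> G) = card (Fix \<psi>' G)"
    by (rule card_Fix_eq)
  show "Inn ?Q \<cong> Inn ?Q'"
    by (rule Inn_cong[OF G.quandle_group_quandle[OF assms(3)] iso])
  show "\<forall>i::nat. i > 0 \<longrightarrow>
      group_quandle G (\<psi> [^]\<^bsub>AutoGroup G\<^esub> i) \<cong>\<^sub>Q group_quandle G (\<psi>' [^]\<^bsub>AutoGroup G\<^esub> i)"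
    by (simp add: group_quandle_pow_iso)
qed

end
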